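(* Let $1<p<s<\infty$, $n\ge2$, let $\Omega\subseteq\mathbb{R}^n$ be a domain, and let $a=(a_1,\dots,a_n)$ be a weight vector as in the context. Then there exists a positive constant $c(p,s)$, depending only on $p$ and $s$, such that for almost all $x\in\Omega$ and all $\xi,\eta\in\mathbb{R}^n$ with $|\xi|_{s,a}>|\eta|_{s,a}$, $$D_{|\cdot|_{s,a}^{p}}(\xi+\eta,\xi)\ge c(p,s)\,|\xi|_{s,a}^{p-s}\sum_{i=1}^{n}|\eta'_{i}|^{2}\left(|\eta'_{i}|+|\xi'_{i}|\right)^{s-2}.$$
   Context: The functions $a_1,\dots,a_n:\Omega\to(0,\infty)$ are Lebesgue measurable and locally equivalent to $1$: for every domain $\omega$ whose closure is a compact subset of $\Omega$ there are constants $0<c_\omega\le C_\omega<\infty$ with $c_\omega\le a_i\le C_\omega$ a.e. in $\omega$. For almost all $x\in\Omega$ and $\xi\in\mathbb{R}^n$, $|\xi|_{s,a}=\left(\sum_{i=1}^n a_i(x)|\xi_i|^s\right)^{1/s}$, and $\xi_i'=a_i(x)^{1/s}\xi_i$ (similarly $\eta_i'$). The Bregman distance of $|\cdot|_{s,a}^p$ is $$D_{|\cdot|_{s,a}^{p}}(\xi+\eta,\xi)=|\xi+\eta|_{s,a}^{p}-|\xi|_{s,a}^{p}-p|\xi|_{s,a}^{p-s}\sum_{i=1}^{n}a_{i}(x)|\xi_{i}|^{s-2}\xi_{i}\eta_{i}.$$ Conventions: $|t|^{s-2}t=0$ for $t=0$, and $t^2(t+\tau)^{s-2}=0$ when $t=\tau=0$.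 *)

theory Defs
  imports "HOL-Analysis.Analysis"
begin

text \<open>
  The constant of the theorem is independent of the dimension, so \<open>n\<close> has to be quantified
  inside the statement and cannot be a type as in \<open>real ^ 'n\<close>. Points of \<open>R^n\<close> are therefore
  the extensional functions on the index set \<open>{1..n}\<close>. This set is the carrier both of
  the topology \<open>powertop_real {1..n}\<close> and of the measure defined below.
\<close>

abbreviation Rn :: "nat \<Rightarrow> (nat \<Rightarrow> real) set" where
  "Rn n \<equiv> {1..n} \<rightarrow>\<^sub>E UNIV"

definition vadd :: "nat \<Rightarrow> (nat \<Rightarrow> real) \<Rightarrow> (nat \<Rightarrow> real) \<Rightarrow> nat \<Rightarrow> real" where
  "vadd n \<xi> \<eta> = (\<lambda>i\<in>{1..n}. \<xi> i + \<eta> i)"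

definition lebesgue_Rn :: "nat \<Rightarrow> (nat \<Rightarrow> real) measure" where
  "lebesgue_Rn n = completion (Pi\<^sub>M {1..n} (\<lambda>_. lborel))"

definition domain_Rn :: "nat \<Rightarrow> (nat \<Rightarrow> real) set \<Rightarrow> bool" where
  "domain_Rn n \<Omega> \<longleftrightarrow>
     \<Omega> \<noteq> {} \<and> openin (powertop_real {1..n}) \<Omega> \<and> connectedin (powertop_real {1..n}) \<Omega>"

text \<open>Only the values \<open>a i x\<close> with \<open>i \<in> {1..n}\<close> and \<open>x \<in> \<Omega>\<close> matter.\<close>

definition weight_vector ::
    "nat \<Rightarrow> (nat \<Rightarrow> real) set \<Rightarrow> (nat \<Rightarrow> (nat \<Rightarrow> real) \<Rightarrow> real) \<Rightarrow> bool" where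
  "weight_vector n \<Omega> a \<longleftrightarrow>
     (\<forall>i\<in>{1..n}. (\<forall>x\<in>\<Omega>. 0 < a i x) \<and>
        a i \<in> borel_measurable (restrict_space (lebesgue_Rn n) \<Omega>)) \<and>
     (\<forall>\<omega>. domain_Rn n \<omega> \<and>
          compactin (powertop_real {1..n}) (powertop_real {1..n} closure_of \<omega>) \<and>
          powertop_real {1..n} closure_of \<omega> \<subseteq> \<Omega> \<longrightarrow>
        (\<exists>c C. 0 < c \<and> c \<le> C \<and>
           (\<forall>i\<in>{1..n}. AE x in lebesgue_Rn n. x \<in> \<omega> \<longrightarrow> c \<le> a i x \<and> a i x \<le> C)))"

definition wnorm ::
    "nat \<Rightarrow> real \<Rightarrow> (nat \<Rightarrow> (nat \<Rightarrow> real) \<Rightarrow> real) \<Rightarrow> (nat \<Rightarrow> real) \<Rightarrow> (nat \<Rightarrow> real) \<Rightarrow> real" where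
  "wnorm n s a x \<xi> = (\<Sum>i=1..n. a i x * \<bar>\<xi> i\<bar> powr s) powr (1 / s)"

text \<open>The vector \<open>\<xi>'\<close> with components \<open>a_i(x)^(1/s) \<xi>_i\<close>.\<close>

definition wscale ::
    "real \<Rightarrow> (nat \<Rightarrow> (nat \<Rightarrow> real) \<Rightarrow> real) \<Rightarrow> (nat \<Rightarrow> real) \<Rightarrow> (nat \<Rightarrow> real) \<Rightarrow> nat \<Rightarrow> real" where
  "wscale s a x \<xi> i = a i x powr (1 / s) * \<xi> i"

text \<open>
  The Bregman distance of the \<open>p\<close>-th power of \<open>wnorm n s a x\<close>. Since \<open>0 powr r = 0\<close>
  for every \<open>r\<close>, the factor \<open>\<bar>\<xi> i\<bar> powr (s - 2) * \<xi> i\<close> vanishes for \<open>\<xi> i = 0\<close>,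
  including when \<open>s \<le> 2\<close>.
\<close>

definition bregman ::
    "nat \<Rightarrow> real \<Rightarrow> real \<Rightarrow> (nat \<Rightarrow> (nat \<Rightarrow> real) \<Rightarrow> real) \<Rightarrow> (nat \<Rightarrow> real)
      \<Rightarrow> (nat \<Rightarrow> real) \<Rightarrow> (nat \<Rightarrow> real) \<Rightarrow> real" where
  "bregman n p s a x \<zeta> \<xi> =
     wnorm n s a x \<zeta> powr p - wnorm n s a x \<xi> powr p
     - p * wnorm n s a x \<xi> powr (p - s)
         * (\<Sum>i=1..n. a i x * (\<bar>\<xi> i\<bar> powr (s - 2) * \<xi> i) * (\<zeta> i - \<xi> i))"

end

theory Submission
  imports Defs "HOL-Real_Asymp.Real_Asymp"
begin

text \<open>
  By scaling assume \<open>|\<xi>| = 1\<close>, write \<open>u\<close>, \<open>v\<close> for \<open>\<xi>'\<close>, \<open>\<eta>'\<close>, and put \<open>N = |u + v|\<close>,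
  \<open>A = \<Sum> |u_i|^(s-2) u_i v_i\<close> and \<open>S = \<Sum> v_i^2 (|v_i| + |u_i|)^(s-2)\<close>, so that the Bregman
  distance is \<open>E = N^p - 1 - p A\<close>. Summing the one-dimensional inequality for the exponent \<open>s\<close>
  gives \<open>N^s \<ge> 1 + s A + \<delta> S\<close> for all small \<open>\<delta> > 0\<close>, and since
  \<open>(1 + y)^(p/s) \<ge> 1 + (p/s) y - y^2\<close>, it follows that
  \<open>E \<ge> (p/s) \<delta> S - 2 s^2 A^2 - 2 \<delta>^2 S^2\<close>. As \<open>S\<close> is bounded, the last term is harmless for
  small \<open>\<delta>\<close>. The term \<open>A^2\<close>, due to the concavity of \<open>t \<mapsto> t^(p/s)\<close>, is absorbed using \<open>p > 1\<close>:
  Hoelder's inequality gives \<open>N \<ge> 1 + A\<close> and \<open>|A| \<le> 1\<close>, whence \<open>E \<ge> (1 + A)^p - 1 - p A \<ge> k A^2\<close>.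
\<close>

section \<open>One-dimensional inequalities for the exponent s\<close>

text \<open>For \<open>t \<le> -1\<close> the left side is already negative. On
  \<open>x > -1\<close> the derivative of \<open>(1 + x)^s - s x\<close> changes sign only at 0,
  which is therefore the strict minimum. Strictness is what keeps the quotient in the next lemma
  positive away from 0.\<close>

lemma strict_Bernoulli_powr:
  fixes s t :: real
  assumes s: "1 < s" and t: "t \<noteq> 0"
  shows "1 + s * t < \<bar>1 + t\<bar> powr s"
proof (cases "t \<le> -1")
  case True
  then have "1 + s * t < 0"
    using s mult_left_mono[of t "-1" s] by simp
  then show ?thesis
    using powr_ge_zero[of "\<bar>1 + t\<bar>" s] by linarith
next
  case False
  define f where "f = (\<lambda>x. (1 + x) powr s - s * x)"
  have f_cont: "isCont f x" if "-1 < x" for x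
    unfolding f_def using that by (intro continuous_intros) auto
  have f': "(f has_real_derivative s * ((1 + x) powr (s - 1) - 1)) (at x)" if "-1 < x" for x
    unfolding f_def using that by (auto intro!: derivative_eq_intros simp: algebra_simps)
  have "f 0 < f t"
  proof (cases "0 < t")
    case True
    show ?thesis
    proof (rule DERIV_pos_imp_increasing_open[OF True])
      fix x :: real assume "0 < x" "x < t"
      moreover have "1 < (1 + x) powr (s - 1)"
        using \<open>0 < x\<close> s by (simp add: gr_one_powr)
      ultimately show "\<exists>y. (f has_real_derivative y) (at x) \<and> 0 < y"
        using f'[of x] s by (intro exI[of _ "s * ((1 + x) powr (s - 1) - 1)"]) simp
    next
      show "continuous_on {0..t} f"
        by (intro continuous_at_imp_continuous_on ballI f_cont) auto
    qed
  next
    case neg: False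
    then have "t < 0" using t by simp
    then show ?thesis
    proof (rule DERIV_neg_imp_decreasing_open)
      fix x :: real assume "t < x" "x < 0"
      moreover have "(1 + x) powr (s - 1) < 1"
        using \<open>x < 0\<close> \<open>t < x\<close> False s powr_less_mono2[of "s - 1" "1 + x" 1] by simp
      ultimately show "\<exists>y. (f has_real_derivative y) (at x) \<and> y < 0"
        using f'[of x] s False
        by (intro exI[of _ "s * ((1 + x) powr (s - 1) - 1)"]) (simp add: mult_less_0_iff)
    next
      show "continuous_on {t..0} f"
        using False by (intro continuous_at_imp_continuous_on ballI f_cont) auto
    qed
  qed
  then show ?thesis
    using False by (simp add: f_def)
qed

text \<open>
  The quotient of the two sides has positive limits at \<open>0\<close> and at infinity and is positive
  and continuous in between.
\<close>

lemma Bernoulli_powr_remainder: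
  fixes s :: real
  assumes s: "1 < s"
  obtains c where "0 < c"
    "\<And>t. c * (t\<^sup>2 * (1 + \<bar>t\<bar>) powr (s - 2)) \<le> \<bar>1 + t\<bar> powr s - 1 - s * t"
proof -
  define d :: "real \<Rightarrow> real" where "d = (\<lambda>t. t\<^sup>2 * (1 + \<bar>t\<bar>) powr (s - 2))"
  define g where "g = (\<lambda>t. (\<bar>1 + t\<bar> powr s - 1 - s * t) / d t)"
  have d_pos: "0 < d t" if "t \<noteq> 0" for t
    using that by (simp add: d_def)
  \<comment> \<open>\<open>m\<close> lies strictly below both limits of \<open>g\<close>: 1 at the
    two infinities, and at 0 the second Taylor coefficient \<open>s (s - 1) / 2\<close> of
    \<open>(1 + t)^s\<close>.\<close>
  define m where "m = min (1/2) (s * (s - 1) / 4)"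
  have "0 < s * (s - 1)" using s by simp
  then have m: "0 < m" "m < 1" "m < s * (s - 1) / 2"
    unfolding m_def by linarith+
  have "(g \<longlongrightarrow> s * (s - 1) / 2) (at_left 0)" "(g \<longlongrightarrow> s * (s - 1) / 2) (at_right 0)"
    "(g \<longlongrightarrow> 1) at_top" "(g \<longlongrightarrow> 1) at_bot"
    unfolding g_def d_def using s by real_asymp+
  then have ev: "\<forall>\<^sub>F t in at 0. m < g t" "\<forall>\<^sub>F t in at_top. m < g t" "\<forall>\<^sub>F t in at_bot. m < g t"
    using m by (auto simp: eventually_at_split intro: order_tendstoD)
  obtain \<epsilon> where \<epsilon>: "0 < \<epsilon>" "\<And>t. t \<noteq> 0 \<Longrightarrow> \<bar>t\<bar> < \<epsilon> \<Longrightarrow> m < g t"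
    using ev(1) by (auto simp: eventually_at dist_real_def)
  obtain M1 where M1: "\<And>t. M1 \<le> t \<Longrightarrow> m < g t"
    using ev(2) by (auto simp: eventually_at_top_linorder)
  obtain M2 where M2: "\<And>t. t \<le> M2 \<Longrightarrow> m < g t"
    using ev(3) by (auto simp: eventually_at_bot_linorder)
  \<comment> \<open>The compact set left after removing the neighbourhoods of 0 and of infinity; it
    may be empty, hence the case split.\<close>
  define K where "K = {M2..M1} - {-\<epsilon><..<\<epsilon>}"
  have "\<exists>m'>0. \<forall>t\<in>K. m' \<le> g t"
  proof (cases "K = {}")
    case False
    have "compact K"
      unfolding K_def by (intro compact_diff) auto
    \<comment> \<open>The base \<open>\<bar>1 + t\<bar>\<close> may vanish, at
      \<open>t = -1\<close>; the power is continuous there because \<open>s > 0\<close>.\<close>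
    moreover have "continuous_on K g"
      unfolding g_def d_def K_def using \<epsilon>(1) s by (intro continuous_on_powr' continuous_intros) auto
    ultimately obtain x where x: "x \<in> K" "\<And>t. t \<in> K \<Longrightarrow> g x \<le> g t"
      using continuous_attains_inf[of K g] False by blast
    then have "x \<noteq> 0"
      using \<epsilon>(1) by (auto simp: K_def)
    then have "0 < g x"
      unfolding g_def using d_pos strict_Bernoulli_powr[OF s, of x] by (simp add: divide_pos_pos)
    then show ?thesis using x by blast
  qed (auto intro: exI[of _ 1])
  then obtain m' where m': "0 < m'" "\<And>t. t \<in> K \<Longrightarrow> m' \<le> g t" by blast
  show thesis
  proof
    show "0 < min m m'" using m m' by simp
    fix t :: real
    show "min m m' * (t\<^sup>2 * (1 + \<bar>t\<bar>) powr (s - 2)) \<le> \<bar>1 + t\<bar> powr s - 1 - s * t"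
    proof (cases "t = 0")
      case False
      have "t \<in> K \<or> \<bar>t\<bar> < \<epsilon> \<or> M1 \<le> t \<or> t \<le> M2"
        by (auto simp: K_def)
      then have "min m m' \<le> g t"
        using m'(2)[of t] \<epsilon>(2)[OF False] M1[of t] M2[of t] by linarith
      then show ?thesis
        using d_pos[OF False] unfolding g_def by (simp add: pos_le_divide_eq d_def)
    qed simp
  qed
qed

text \<open>Both sides are homogeneous of degree \<open>s\<close> in \<open>(a, b)\<close>, so for
  \<open>a \<noteq> 0\<close> the substitution \<open>b = a t\<close> reduces the claim to the
  previous lemma.\<close>

lemma bregman_powr_lower_bound:
  fixes s :: real
  assumes s: "1 < s"
  obtains c where "0 < c"
    "\<And>a b. c * (b\<^sup>2 * (\<bar>b\<bar> + \<bar>a\<bar>) powr (s - 2))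
       \<le> \<bar>a + b\<bar> powr s - \<bar>a\<bar> powr s - s * (\<bar>a\<bar> powr (s - 2) * a * b)"
proof -
  obtain c where c: "0 < c"
    "\<And>t. c * (t\<^sup>2 * (1 + \<bar>t\<bar>) powr (s - 2)) \<le> \<bar>1 + t\<bar> powr s - 1 - s * t"
    using Bernoulli_powr_remainder[OF s] by blast
  show thesis
  proof
    \<comment> \<open>The cap at 1 serves \<open>a = 0\<close>, where the right side is exactly
      \<open>\<bar>b\<bar> powr s\<close>.\<close>
    show "0 < min c 1" using c by simp
    fix a b :: real
    show "min c 1 * (b\<^sup>2 * (\<bar>b\<bar> + \<bar>a\<bar>) powr (s - 2))
       \<le> \<bar>a + b\<bar> powr s - \<bar>a\<bar> powr s - s * (\<bar>a\<bar> powr (s - 2) * a * b)"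
    proof (cases "a = 0")
      case True
      have "b\<^sup>2 * \<bar>b\<bar> powr (s - 2) = \<bar>b\<bar> powr s"
        by (cases "b = 0") (simp_all add: powr_diff)
      then show ?thesis
        using True mult_right_mono[of "min c 1" 1 "\<bar>b\<bar> powr s"] by simp
    next
      case False
      define t where "t = b / a"
      have b: "b = a * t" using False by (simp add: t_def)
      have sq: "a\<^sup>2 * \<bar>a\<bar> powr (s - 2) = \<bar>a\<bar> powr s"
        using False by (simp add: powr_diff)
      have "\<bar>b\<bar> + \<bar>a\<bar> = \<bar>a\<bar> * (1 + \<bar>t\<bar>)"
        by (simp add: b abs_mult algebra_simps)
      then have 1: "b\<^sup>2 * (\<bar>b\<bar> + \<bar>a\<bar>) powr (s - 2)
          = \<bar>a\<bar> powr s * (t\<^sup>2 * (1 + \<bar>t\<bar>) powr (s - 2))"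
        by (simp add: b powr_mult power_mult_distrib flip: sq)
      have "\<bar>a + b\<bar> = \<bar>a\<bar> * \<bar>1 + t\<bar>"
        by (simp add: b algebra_simps flip: abs_mult)
      then have 2: "\<bar>a + b\<bar> powr s = \<bar>a\<bar> powr s * \<bar>1 + t\<bar> powr s"
        by (simp add: powr_mult)
      have 3: "\<bar>a\<bar> powr (s - 2) * a * b = \<bar>a\<bar> powr s * t"
        by (simp add: b power2_eq_square flip: sq)
      have "min c 1 * (t\<^sup>2 * (1 + \<bar>t\<bar>) powr (s - 2)) \<le> c * (t\<^sup>2 * (1 + \<bar>t\<bar>) powr (s - 2))"
        by (intro mult_right_mono) auto
      from mult_left_mono[OF order_trans[OF this c(2)], of "\<bar>a\<bar> powr s"]
      show ?thesis
        unfolding 1 2 3 by (simp add: algebra_simps)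
    qed
  qed
qed

section \<open>A quadratic lower bound for concave powers\<close>

text \<open>For \<open>y > -1\<close>, Young's inequality gives \<open>(1 + y)^(1-q) \<le> D\<close>
  with \<open>D = 1 + (1-q) y\<close>, hence \<open>(1 + y)^q \<ge> (1 + y) / D\<close>; multiplying
  out shows that \<open>(1 + q y - y^2) D\<close> is at most \<open>1 + y\<close>. For
  \<open>y \<le> -1\<close> the left side is not positive. The separate \<open>z\<close> allows
  \<open>1 + y\<close> to be negative.\<close>

lemma powr_concave_quadratic_lower_bound:
  fixes q y z :: real
  assumes q: "0 \<le> q" "q \<le> 1" and z: "0 \<le> z" "1 + y \<le> z"
  shows "1 + q * y - y\<^sup>2 \<le> z powr q"
proof (cases "y \<le> -1")
  case True
  have "q * y \<le> 0"
    using q True by (simp add: mult_nonneg_nonpos)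
  moreover have "1 \<le> y\<^sup>2"
    using True mult_mono[of 1 "-y" 1 "-y"] by (simp add: power2_eq_square)
  ultimately show ?thesis
    using powr_ge_zero[of z q] by linarith
next
  case False
  define D where "D = 1 + (1 - q) * y"
  have "(1 + y) powr (1 - q) * 1 powr q \<le> (1 - q) * (1 + y) + q * 1"
    using q False by (intro Youngs_inequality_0) auto
  then have D: "(1 + y) powr (1 - q) \<le> D"
    by (simp add: D_def algebra_simps)
  have "0 < (1 + y) powr (1 - q)" using False by simp
  then have D0: "0 < D" using D by linarith
  have "(1 + q * y - y\<^sup>2) * D = 1 + y - y\<^sup>2 * (q\<^sup>2 + (1 - q) * (1 + y))"
    by (simp add: D_def power2_eq_square algebra_simps)
  also have "\<dots> \<le> 1 + y"
    using False q by (auto intro!: mult_nonneg_nonneg add_nonneg_nonneg)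
  also have "1 + y = (1 + y) powr q * (1 + y) powr (1 - q)"
    using False by (simp flip: powr_add)
  also have "\<dots> \<le> (1 + y) powr q * D"
    using D by (intro mult_left_mono) auto
  finally have "1 + q * y - y\<^sup>2 \<le> (1 + y) powr q"
    using D0 by simp
  also have "\<dots> \<le> z powr q"
    using False q z by (intro powr_mono2) auto
  finally show ?thesis .
qed

section \<open>The unweighted l^s norm and Hoelder's inequality\<close>

definition lnorm :: "real \<Rightarrow> 'a set \<Rightarrow> ('a \<Rightarrow> real) \<Rightarrow> real" where
  "lnorm s I u = (\<Sum>i\<in>I. \<bar>u i\<bar> powr s) powr (1 / s)"

lemma lnorm_nonneg: "0 \<le> lnorm s I u"
  by (simp add: lnorm_def)

lemma lnorm_powr:
  assumes "s \<noteq> 0"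
  shows "lnorm s I u powr s = (\<Sum>i\<in>I. \<bar>u i\<bar> powr s)"
  using assms by (simp add: lnorm_def powr_powr sum_nonneg)

lemma lnorm_scale:
  assumes "0 < s" "0 \<le> r"
  shows "lnorm s I (\<lambda>i. r * u i) = r * lnorm s I u"
proof -
  have "(\<Sum>i\<in>I. \<bar>r * u i\<bar> powr s) = r powr s * (\<Sum>i\<in>I. \<bar>u i\<bar> powr s)"
    using assms by (simp add: abs_mult powr_mult sum_distrib_left)
  then show ?thesis
    using assms by (simp add: lnorm_def powr_mult powr_powr sum_nonneg)
qed

lemma abs_powr_minus_2_mult:
  fixes a s :: real
  shows "\<bar>a\<bar> powr (s - 2) * \<bar>a\<bar> = \<bar>a\<bar> powr (s - 1)"
  using powr_mult_base[of "\<bar>a\<bar>" "s - 2"] by (simp add: mult.commute)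

text \<open>Hoelder's inequality with exponents \<open>s / (s - 1)\<close> and \<open>s\<close>,
  where the factor from \<open>u\<close> equals 1. Equivalently, the left side is the derivative of
  the norm at the unit vector \<open>u\<close> in direction \<open>w\<close>. The proof applies
  Young's inequality to \<open>w / N\<close>, so \<open>w = 0\<close> is treated first.\<close>

lemma sum_powr_mult_le_lnorm:
  fixes u w :: "'a \<Rightarrow> real"
  assumes s: "1 < s" and fin: "finite I" and u: "(\<Sum>i\<in>I. \<bar>u i\<bar> powr s) = 1"
  shows "(\<Sum>i\<in>I. \<bar>u i\<bar> powr (s - 2) * u i * w i) \<le> lnorm s I w"
proof (cases "(\<Sum>i\<in>I. \<bar>w i\<bar> powr s) = 0")
  case True
  then have "\<And>i. i \<in> I \<Longrightarrow> w i = 0"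
    using fin by (simp add: sum_nonneg_eq_0_iff)
  then show ?thesis
    by (simp add: lnorm_nonneg)
next
  case False
  define N where "N = lnorm s I w"
  have "0 < N"
    using False unfolding N_def lnorm_def by (simp add: sum_nonneg)
  have Ns: "N powr s = (\<Sum>i\<in>I. \<bar>w i\<bar> powr s)"
    unfolding N_def using s by (simp add: lnorm_powr)
  have Ns0: "N powr s > 0" using \<open>0 < N\<close> by simp
  have summand: "\<bar>u i\<bar> powr (s - 2) * u i * w i
      \<le> N * ((1 - 1 / s) * \<bar>u i\<bar> powr s + \<bar>w i\<bar> powr s / N powr s / s)" for i
  proof -
    have "\<bar>u i\<bar> powr (s - 2) * u i * w i \<le> \<bar>u i\<bar> powr (s - 2) * \<bar>u i * w i\<bar>"
      by (simp add: mult_left_mono mult.assoc)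
    also have "\<dots> = \<bar>u i\<bar> powr (s - 1) * \<bar>w i\<bar>"
      by (simp add: abs_mult flip: abs_powr_minus_2_mult)
    also have "\<dots> = N * (\<bar>u i\<bar> powr (s - 1) * (\<bar>w i\<bar> / N))"
      using \<open>0 < N\<close> by simp
    also have "\<bar>u i\<bar> powr (s - 1) * (\<bar>w i\<bar> / N)
        \<le> (\<bar>u i\<bar> powr (s - 1)) powr (s / (s - 1)) / (s / (s - 1)) + (\<bar>w i\<bar> / N) powr s / s"
      using s \<open>0 < N\<close> by (intro Youngs_inequality) (auto simp: field_simps)
    also have "\<dots> = (1 - 1 / s) * \<bar>u i\<bar> powr s + \<bar>w i\<bar> powr s / N powr s / s"
    proof -
      have "(s - 1) * (s / (s - 1)) = s" "1 / (s / (s - 1)) = 1 - 1 / s"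
        using s by (simp_all add: field_simps)
      moreover have "\<bar>u i\<bar> powr s / (s / (s - 1)) = 1 / (s / (s - 1)) * \<bar>u i\<bar> powr s"
        by simp
      ultimately show ?thesis
        using \<open>0 < N\<close> by (simp only: powr_powr powr_divide abs_ge_zero less_imp_le)
    qed
    finally show ?thesis
      using \<open>0 < N\<close> by simp
  qed
  have "(\<Sum>i\<in>I. \<bar>u i\<bar> powr (s - 2) * u i * w i)
      \<le> (\<Sum>i\<in>I. N * ((1 - 1 / s) * \<bar>u i\<bar> powr s + \<bar>w i\<bar> powr s / N powr s / s))"
    by (intro sum_mono summand)
  also have "\<dots> = N * ((1 - 1 / s) * (\<Sum>i\<in>I. \<bar>u i\<bar> powr s)
      + (\<Sum>i\<in>I. \<bar>w i\<bar> powr s) / N powr s / s)"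
    by (simp only: sum.distrib flip: sum_distrib_left sum_divide_distrib)
  also have "\<dots> = N"
    using u Ns0 by (simp flip: Ns)
  finally show ?thesis
    by (simp add: N_def)
qed

text \<open>Enlarging \<open>b^2\<close> to \<open>r^2\<close> leaves the pure power
  \<open>r^s\<close>, so the sign of \<open>s - 2\<close> is irrelevant. Summed over the indices,
  this bounds \<open>S\<close>.\<close>

lemma sq_mult_powr_le:
  fixes a b s :: real
  assumes "0 \<le> s"
  shows "b\<^sup>2 * (\<bar>b\<bar> + \<bar>a\<bar>) powr (s - 2) \<le> 2 powr s * (\<bar>a\<bar> powr s + \<bar>b\<bar> powr s)"
proof -
  define r where "r = \<bar>b\<bar> + \<bar>a\<bar>"
  define m where "m = max \<bar>a\<bar> \<bar>b\<bar>"
  have "b\<^sup>2 * r powr (s - 2) \<le> r\<^sup>2 * r powr (s - 2)"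
    unfolding r_def by (intro mult_right_mono abs_le_square_iff[THEN iffD1]) auto
  also have "\<dots> = r powr s"
    by (cases "r = 0") (simp_all add: powr_diff r_def)
  also have "\<dots> \<le> (2 * m) powr s"
    using assms by (intro powr_mono2) (auto simp: r_def m_def)
  also have "\<dots> = 2 powr s * m powr s"
    by (simp add: powr_mult m_def)
  also have "m powr s \<le> \<bar>a\<bar> powr s + \<bar>b\<bar> powr s"
    by (simp add: m_def max_def)
  finally show ?thesis
    by (simp add: r_def)
qed

section \<open>The unweighted Bregman distance\<close>

lemma bregman_lnorm_lower_bound_normalized:
  fixes p s :: real
  assumes p: "1 < p" and ps: "p < s"
  obtains c where "0 < c"
    "\<And>(I :: 'a set) u v. finite I \<Longrightarrow> (\<Sum>i\<in>I. \<bar>u i\<bar> powr s) = 1 \<Longrightarrow> (\<Sum>i\<in>I. \<bar>v i\<bar> powr s) \<le> 1 \<Longrightarrow>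
       c * (\<Sum>i\<in>I. (v i)\<^sup>2 * (\<bar>v i\<bar> + \<bar>u i\<bar>) powr (s - 2))
       \<le> lnorm s I (\<lambda>i. u i + v i) powr p - 1 - p * (\<Sum>i\<in>I. \<bar>u i\<bar> powr (s - 2) * u i * v i)"
proof -
  have s: "1 < s" using p ps by simp
  obtain c1 where c1: "0 < c1" "\<And>a b. c1 * (b\<^sup>2 * (\<bar>b\<bar> + \<bar>a\<bar>) powr (s - 2))
       \<le> \<bar>a + b\<bar> powr s - \<bar>a\<bar> powr s - s * (\<bar>a\<bar> powr (s - 2) * a * b)"
    using bregman_powr_lower_bound[OF s] by blast
  obtain c2 where c2: "0 < c2"
    "\<And>t. c2 * (t\<^sup>2 * (1 + \<bar>t\<bar>) powr (p - 2)) \<le> \<bar>1 + t\<bar> powr p - 1 - p * t"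
    using Bernoulli_powr_remainder[OF p] by blast
  \<comment> \<open>For \<open>\<bar>A\<bar> \<le> 1\<close> the base
    \<open>1 + \<bar>A\<bar>\<close> lies in \<open>[1, 2]\<close>, so its power
    \<open>p - 2\<close> is at least this minimum, whatever the sign of
    \<open>p - 2\<close>.\<close>
  define k where "k = c2 * min 1 (2 powr (p - 2))"
  have "0 < k" using c2(1) by (simp add: k_def)
  define q where "q = p / s"
  have q: "0 < q" "q < 1" "q * s = p" using p ps by (auto simp: q_def)
  define B :: real where "B = 2 powr s * 2"
  have "0 < B" by (simp add: B_def)
  \<comment> \<open>The first bound keeps the summed one-dimensional inequality valid; the second
    gives \<open>2 (\<delta> S)^2 \<le> (q/2) \<delta> S\<close> whenever
    \<open>0 \<le> S \<le> B\<close>.\<close>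
  define \<delta> where "\<delta> = min c1 (q / (4 * B))"
  have \<delta>: "0 < \<delta>" "\<delta> \<le> c1" using c1 q \<open>0 < B\<close> by (auto simp: \<delta>_def)
  have "\<delta> \<le> q / (4 * B)" by (simp add: \<delta>_def)
  then have \<delta>B: "2 * (\<delta> * B) \<le> q / 2" using \<open>0 < B\<close> by (simp add: field_simps)
  \<comment> \<open>\<open>K - 1\<close> is the multiple of \<open>E\<close> that pays for
    \<open>2 s^2 A^2\<close>, since \<open>k A^2 \<le> E\<close>.\<close>
  define K where "K = 1 + 2 * s\<^sup>2 / k"
  have K: "0 < K" using \<open>0 < k\<close> by (simp add: K_def add_pos_nonneg)
  show thesis
  proof
    show "0 < \<delta> * q / 2 / K" using \<delta> q K by simp
    fix I :: "'a set" and u v :: "'a \<Rightarrow> real"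
    assume fin: "finite I" and u: "(\<Sum>i\<in>I. \<bar>u i\<bar> powr s) = 1" and v: "(\<Sum>i\<in>I. \<bar>v i\<bar> powr s) \<le> 1"
    define A where "A = (\<Sum>i\<in>I. \<bar>u i\<bar> powr (s - 2) * u i * v i)"
    define S where "S = (\<Sum>i\<in>I. (v i)\<^sup>2 * (\<bar>v i\<bar> + \<bar>u i\<bar>) powr (s - 2))"
    define N where "N = lnorm s I (\<lambda>i. u i + v i)"
    define E where "E = N powr p - 1 - p * A"
    have "0 \<le> S" unfolding S_def by (intro sum_nonneg) simp
    have "S \<le> (\<Sum>i\<in>I. 2 powr s * (\<bar>u i\<bar> powr s + \<bar>v i\<bar> powr s))"
      unfolding S_def using s by (intro sum_mono sq_mult_powr_le) simp
    also have "\<dots> = 2 powr s * (1 + (\<Sum>i\<in>I. \<bar>v i\<bar> powr s))"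
      by (simp only: sum.distrib u flip: sum_distrib_left)
    also have "\<dots> \<le> B"
      unfolding B_def using v by (intro mult_left_mono) auto
    finally have "S \<le> B" .

    have usq: "\<bar>x\<bar> powr (s - 2) * x * x = \<bar>x\<bar> powr s" for x :: real
      by (cases "x = 0") (simp_all add: powr_diff power2_eq_square)
    have v1: "lnorm s I v \<le> 1"
      using v s by (simp add: lnorm_def powr_le1 sum_nonneg)
    have "A \<le> 1"
      using sum_powr_mult_le_lnorm[OF s fin u, of v] v1 by (simp add: A_def)
    have "lnorm s I (\<lambda>i. - v i) = lnorm s I v"
      by (simp add: lnorm_def)
    then have "-1 \<le> A"
      using sum_powr_mult_le_lnorm[OF s fin u, of "\<lambda>i. - v i"] v1 by (simp add: A_def sum_negf)
    \<comment> \<open>Taking \<open>w = u + v\<close> in Hoelder's inequality yields the supporting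
      hyperplane of the norm at \<open>u\<close>.\<close>
    have "(\<Sum>i\<in>I. \<bar>u i\<bar> powr (s - 2) * u i * (u i + v i)) = 1 + A"
      by (simp add: distrib_left sum.distrib usq u A_def)
    then have "1 + A \<le> N"
      using sum_powr_mult_le_lnorm[OF s fin u, of "\<lambda>i. u i + v i"] by (simp add: N_def)

    have "min 1 (2 powr (p - 2)) \<le> (1 + \<bar>A\<bar>) powr (p - 2)"
    proof (cases "2 \<le> p")
      case True
      then show ?thesis by (intro min.coboundedI1 ge_one_powr_ge_zero) auto
    next
      case False
      then show ?thesis
        using \<open>A \<le> 1\<close> \<open>-1 \<le> A\<close> by (intro min.coboundedI2 powr_mono2') auto
    qed
    then have "c2 * A\<^sup>2 * min 1 (2 powr (p - 2)) \<le> c2 * A\<^sup>2 * (1 + \<bar>A\<bar>) powr (p - 2)"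
      using c2(1) by (intro mult_left_mono) auto
    then have "k * A\<^sup>2 \<le> c2 * (A\<^sup>2 * (1 + \<bar>A\<bar>) powr (p - 2))"
      by (simp add: k_def mult_ac)
    also have "\<dots> \<le> \<bar>1 + A\<bar> powr p - 1 - p * A" by (rule c2(2))
    also have "\<bar>1 + A\<bar> powr p \<le> N powr p"
      using \<open>1 + A \<le> N\<close> \<open>-1 \<le> A\<close> p by (intro powr_mono2) auto
    finally have first: "k * A\<^sup>2 \<le> E" by (simp add: E_def)

    define y where "y = s * A + \<delta> * S"
    have "c1 * S \<le> (\<Sum>i\<in>I. \<bar>u i + v i\<bar> powr s - \<bar>u i\<bar> powr s - s * (\<bar>u i\<bar> powr (s - 2) * u i * v i))"
      unfolding S_def sum_distrib_left by (intro sum_mono c1(2))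
    also have "\<dots> = N powr s - 1 - s * A"
      using s by (simp only: sum_subtractf u A_def N_def lnorm_powr flip: sum_distrib_left)
    finally have "1 + y \<le> N powr s"
      using mult_right_mono[OF \<delta>(2) \<open>0 \<le> S\<close>] by (simp add: y_def)
    then have "1 + q * y - y\<^sup>2 \<le> (N powr s) powr q"
      using q by (intro powr_concave_quadratic_lower_bound) auto
    also have "\<dots> = N powr p"
      using q by (simp add: powr_powr mult.commute)
    \<comment> \<open>Since \<open>q s = p\<close>, the linear term \<open>q s A\<close> cancels
      against \<open>p A\<close> in \<open>E\<close>.\<close>
    finally have "q * \<delta> * S - y\<^sup>2 \<le> E"
      using q(3) by (simp add: E_def y_def algebra_simps)
    moreover have "y\<^sup>2 \<le> 2 * s\<^sup>2 * A\<^sup>2 + 2 * (\<delta> * S)\<^sup>2"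
      using sum_squares_bound[of "s * A" "\<delta> * S"]
      by (simp add: y_def power2_sum power_mult_distrib mult_ac)
    moreover have "2 * (\<delta> * S)\<^sup>2 \<le> q / 2 * (\<delta> * S)"
    proof -
      have "2 * (\<delta> * S) \<le> 2 * (\<delta> * B)" using \<delta> \<open>S \<le> B\<close> by simp
      then have "2 * (\<delta> * S) \<le> q / 2" using \<delta>B by linarith
      from mult_right_mono[OF this, of "\<delta> * S"] show ?thesis
        using \<delta> \<open>0 \<le> S\<close> by (simp add: power2_eq_square mult.assoc)
    qed
    moreover have "2 * s\<^sup>2 * A\<^sup>2 \<le> (K - 1) * E"
    proof -
      have "2 * s\<^sup>2 * A\<^sup>2 = (K - 1) * (k * A\<^sup>2)"
        using \<open>0 < k\<close> by (simp add: K_def)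
      also have "\<dots> \<le> (K - 1) * E"
        using first \<open>0 < k\<close> by (intro mult_left_mono) (auto simp: K_def)
      finally show ?thesis .
    qed
    \<comment> \<open>Half of \<open>q \<delta> S\<close> absorbs the square of
      \<open>\<delta> S\<close>; the remaining half is bounded by
      \<open>E + (K - 1) E\<close>.\<close>
    ultimately have "\<delta> * q / 2 * S \<le> K * E"
      by (simp add: algebra_simps)
    then have "\<delta> * q / 2 / K * S \<le> E"
      using K by (simp add: field_simps)
    then show "\<delta> * q / 2 / K * (\<Sum>i\<in>I. (v i)\<^sup>2 * (\<bar>v i\<bar> + \<bar>u i\<bar>) powr (s - 2))
       \<le> lnorm s I (\<lambda>i. u i + v i) powr p - 1 - p * (\<Sum>i\<in>I. \<bar>u i\<bar> powr (s - 2) * u i * v i)"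
      by (simp add: S_def E_def A_def N_def)
  qed
qed

text \<open>Dividing both vectors by \<open>r = lnorm s I u\<close> reduces to the normalized case,
  because every term scales by \<open>r^p = r^(p-s) r^s\<close>. The strict inequality between the
  norms ensures \<open>r > 0\<close>.\<close>

lemma bregman_lnorm_lower_bound:
  fixes p s :: real
  assumes p: "1 < p" and ps: "p < s"
  obtains c where "0 < c"
    "\<And>(I :: 'a set) u v. finite I \<Longrightarrow> lnorm s I v < lnorm s I u \<Longrightarrow>
       c * lnorm s I u powr (p - s) * (\<Sum>i\<in>I. (v i)\<^sup>2 * (\<bar>v i\<bar> + \<bar>u i\<bar>) powr (s - 2))
       \<le> lnorm s I (\<lambda>i. u i + v i) powr p - lnorm s I u powr p
          - p * lnorm s I u powr (p - s) * (\<Sum>i\<in>I. \<bar>u i\<bar> powr (s - 2) * u i * v i)"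
proof -
  have s: "1 < s" using p ps by simp
  obtain c where c: "0 < c"
    "\<And>(I :: 'a set) u v. finite I \<Longrightarrow> (\<Sum>i\<in>I. \<bar>u i\<bar> powr s) = 1 \<Longrightarrow> (\<Sum>i\<in>I. \<bar>v i\<bar> powr s) \<le> 1 \<Longrightarrow>
       c * (\<Sum>i\<in>I. (v i)\<^sup>2 * (\<bar>v i\<bar> + \<bar>u i\<bar>) powr (s - 2))
       \<le> lnorm s I (\<lambda>i. u i + v i) powr p - 1 - p * (\<Sum>i\<in>I. \<bar>u i\<bar> powr (s - 2) * u i * v i)"
    using bregman_lnorm_lower_bound_normalized[OF p ps] by blast
  show thesis
  proof
    fix I :: "'a set" and U V :: "'a \<Rightarrow> real"
    assume fin: "finite I" and VU: "lnorm s I V < lnorm s I U"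
    define r where "r = lnorm s I U"
    have r: "0 < r" using VU lnorm_nonneg[of s I V] by (simp add: r_def)
    define u where "u = (\<lambda>i. U i / r)"
    define v where "v = (\<lambda>i. V i / r)"
    have U: "U = (\<lambda>i. r * u i)" and V: "V = (\<lambda>i. r * v i)"
      using r by (auto simp: u_def v_def)
    have "lnorm s I U = r * lnorm s I u"
      using lnorm_scale[of s r I u] s r by (simp flip: U)
    then have "lnorm s I u = 1" using r by (simp flip: r_def)
    then have u1: "(\<Sum>i\<in>I. \<bar>u i\<bar> powr s) = 1"
      using s by (simp flip: lnorm_powr)
    have "lnorm s I V = r * lnorm s I v"
      using lnorm_scale[of s r I v] s r by (simp flip: V)
    then have "lnorm s I v \<le> 1" using r VU by (simp flip: r_def)
    then have v1: "(\<Sum>i\<in>I. \<bar>v i\<bar> powr s) \<le> 1"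
      using s by (simp add: powr_le1 lnorm_nonneg flip: lnorm_powr)
    have rs: "r\<^sup>2 * r powr (s - 2) = r powr s"
      using r by (simp add: powr_diff)
    have rp: "r powr (p - s) * r powr s = r powr p"
      by (simp flip: powr_add)
    have "\<bar>V i\<bar> + \<bar>U i\<bar> = r * (\<bar>v i\<bar> + \<bar>u i\<bar>)" for i
      using r by (simp add: U V abs_mult distrib_left)
    then have 1: "(V i)\<^sup>2 * (\<bar>V i\<bar> + \<bar>U i\<bar>) powr (s - 2)
        = r powr s * ((v i)\<^sup>2 * (\<bar>v i\<bar> + \<bar>u i\<bar>) powr (s - 2))" for i
      using r by (simp add: powr_mult V power_mult_distrib flip: rs)
    have 2: "\<bar>U i\<bar> powr (s - 2) * U i * V i = r powr s * (\<bar>u i\<bar> powr (s - 2) * u i * v i)" for i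
      using r by (simp add: U V abs_mult powr_mult power2_eq_square flip: rs)
    have "(\<lambda>i. U i + V i) = (\<lambda>i. r * (u i + v i))"
      by (simp add: U V distrib_left)
    then have 3: "lnorm s I (\<lambda>i. U i + V i) powr p = r powr p * lnorm s I (\<lambda>i. u i + v i) powr p"
      using s r lnorm_scale[of s r I "\<lambda>i. u i + v i"] by (simp add: powr_mult lnorm_nonneg)
    show "c * lnorm s I U powr (p - s) * (\<Sum>i\<in>I. (V i)\<^sup>2 * (\<bar>V i\<bar> + \<bar>U i\<bar>) powr (s - 2))
       \<le> lnorm s I (\<lambda>i. U i + V i) powr p - lnorm s I U powr p
          - p * lnorm s I U powr (p - s) * (\<Sum>i\<in>I. \<bar>U i\<bar> powr (s - 2) * U i * V i)"
      using mult_left_mono[OF c(2)[OF fin u1 v1], of "r powr p"]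
      unfolding 1 2 3 r_def[symmetric] sum_distrib_left[symmetric] rp[symmetric]
      by (simp add: algebra_simps)
  qed (rule c(1))
qed

section \<open>Absorbing the weights into the vectors\<close>

text \<open>Both expressions have total degree \<open>s\<close> in the factor
  \<open>a_i(x)^(1/s)\<close>, which therefore comes out as \<open>a_i(x)\<close>.\<close>

lemma wscale_terms:
  fixes s :: real
  assumes s: "s \<noteq> 0" and a: "0 < a i x"
  shows "\<bar>wscale s a x \<xi> i\<bar> powr s = a i x * \<bar>\<xi> i\<bar> powr s"
    and "\<bar>wscale s a x \<xi> i\<bar> powr (s - 2) * wscale s a x \<xi> i * wscale s a x \<eta> i
      = a i x * (\<bar>\<xi> i\<bar> powr (s - 2) * \<xi> i) * \<eta> i"
proof -
  define b where "b = a i x powr (1 / s)"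
  have b: "0 < b" using a by (simp add: b_def)
  have bs: "b powr s = a i x" using s a by (simp add: b_def powr_powr)
  have bsq: "b * b * b powr (s - 2) = a i x"
    using b by (simp add: powr_diff power2_eq_square flip: bs)
  show "\<bar>wscale s a x \<xi> i\<bar> powr s = a i x * \<bar>\<xi> i\<bar> powr s"
    using b by (simp add: wscale_def abs_mult powr_mult bs flip: b_def)
  have "\<bar>wscale s a x \<xi> i\<bar> powr (s - 2) * wscale s a x \<xi> i * wscale s a x \<eta> i
      = b * b * b powr (s - 2) * (\<bar>\<xi> i\<bar> powr (s - 2) * \<xi> i) * \<eta> i"
    using b by (simp add: wscale_def abs_mult powr_mult flip: b_def)
  then show "\<bar>wscale s a x \<xi> i\<bar> powr (s - 2) * wscale s a x \<xi> i * wscale s a x \<eta> i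
      = a i x * (\<bar>\<xi> i\<bar> powr (s - 2) * \<xi> i) * \<eta> i"
    by (simp only: bsq)
qed

lemma wnorm_eq_lnorm:
  assumes "s \<noteq> 0" and "\<forall>i\<in>{1..n}. 0 < a i x"
  shows "wnorm n s a x \<xi> = lnorm s {1..n} (wscale s a x \<xi>)"
  using assms by (simp add: wnorm_def lnorm_def wscale_terms(1))

lemma wnorm_vadd_eq_lnorm:
  assumes "s \<noteq> 0" and "\<forall>i\<in>{1..n}. 0 < a i x"
  shows "wnorm n s a x (vadd n \<xi> \<eta>) = lnorm s {1..n} (\<lambda>i. wscale s a x \<xi> i + wscale s a x \<eta> i)"
proof -
  \<comment> \<open>The two vectors are compared only through \<open>lnorm\<close>:
    \<open>vadd\<close> is \<open>undefined\<close> outside \<open>{1..n}\<close>, so they need not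
    agree as functions.\<close>
  have "lnorm s {1..n} (wscale s a x (vadd n \<xi> \<eta>))
      = lnorm s {1..n} (\<lambda>i. wscale s a x \<xi> i + wscale s a x \<eta> i)"
    unfolding lnorm_def by (simp add: wscale_def vadd_def distrib_left)
  then show ?thesis
    using wnorm_eq_lnorm[of s n a x, OF assms] by simp
qed

lemma bregman_vadd_eq_lnorm:
  assumes "s \<noteq> 0" and "\<forall>i\<in>{1..n}. 0 < a i x"
  shows "bregman n p s a x (vadd n \<xi> \<eta>) \<xi>
    = lnorm s {1..n} (\<lambda>i. wscale s a x \<xi> i + wscale s a x \<eta> i) powr p
      - lnorm s {1..n} (wscale s a x \<xi>) powr p
      - p * lnorm s {1..n} (wscale s a x \<xi>) powr (p - s)
        * (\<Sum>i=1..n. \<bar>wscale s a x \<xi> i\<bar> powr (s - 2) * wscale s a x \<xi> i * wscale s a x \<eta> i)"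
proof -
  have "(\<Sum>i=1..n. a i x * (\<bar>\<xi> i\<bar> powr (s - 2) * \<xi> i) * (vadd n \<xi> \<eta> i - \<xi> i))
      = (\<Sum>i=1..n. \<bar>wscale s a x \<xi> i\<bar> powr (s - 2) * wscale s a x \<xi> i * wscale s a x \<eta> i)"
    using assms by (intro sum.cong) (simp_all add: wscale_terms(2) vadd_def)
  then show ?thesis
    unfolding bregman_def
    using wnorm_eq_lnorm[of s n a x, OF assms] wnorm_vadd_eq_lnorm[of s n a x, OF assms] by simp
qed

theorem lemma3p16:
  fixes p s :: real
  assumes "1 < p" and "p < s"
  shows "\<exists>c>0. \<forall>n\<ge>2. \<forall>\<Omega> a. domain_Rn n \<Omega> \<longrightarrow> weight_vector n \<Omega> a \<longrightarrow>
    (AE x in lebesgue_Rn n. x \<in> \<Omega> \<longrightarrow>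
      (\<forall>\<xi>\<in>Rn n. \<forall>\<eta>\<in>Rn n. wnorm n s a x \<xi> > wnorm n s a x \<eta> \<longrightarrow>
        bregman n p s a x (vadd n \<xi> \<eta>) \<xi> \<ge>
          c * wnorm n s a x \<xi> powr (p - s) *
            (\<Sum>i=1..n. \<bar>wscale s a x \<eta> i\<bar>\<^sup>2 *
               (\<bar>wscale s a x \<eta> i\<bar> + \<bar>wscale s a x \<xi> i\<bar>) powr (s - 2))))"
proof -
  have s: "s \<noteq> 0" using assms by simp
  obtain c where "0 < c" and c:
    "\<And>(I :: nat set) u v. finite I \<Longrightarrow> lnorm s I v < lnorm s I u \<Longrightarrow>
       c * lnorm s I u powr (p - s) * (\<Sum>i\<in>I. (v i)\<^sup>2 * (\<bar>v i\<bar> + \<bar>u i\<bar>) powr (s - 2))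
       \<le> lnorm s I (\<lambda>i. u i + v i) powr p - lnorm s I u powr p
          - p * lnorm s I u powr (p - s) * (\<Sum>i\<in>I. \<bar>u i\<bar> powr (s - 2) * u i * v i)"
    using bregman_lnorm_lower_bound[OF assms] by blast
  show ?thesis
  \<comment> \<open>The bound is proved at every point of \<open>\<Omega>\<close>, where
    \<open>weight_vector\<close> makes all the weights positive.\<close>
  proof (intro exI[of _ c] conjI \<open>0 < c\<close> allI impI AE_I2 ballI)
    fix n :: nat and \<Omega> a x \<xi> \<eta>
    assume "weight_vector n \<Omega> a" "x \<in> \<Omega>" and less: "wnorm n s a x \<xi> > wnorm n s a x \<eta>"
    then have pos: "\<forall>i\<in>{1..n}. 0 < a i x"
      by (auto simp: weight_vector_def)
    note eqs = wnorm_eq_lnorm[of s n a x, OF s pos] bregman_vadd_eq_lnorm[of s n a x, OF s pos]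
    show "bregman n p s a x (vadd n \<xi> \<eta>) \<xi> \<ge>
          c * wnorm n s a x \<xi> powr (p - s) *
            (\<Sum>i=1..n. \<bar>wscale s a x \<eta> i\<bar>\<^sup>2 *
               (\<bar>wscale s a x \<eta> i\<bar> + \<bar>wscale s a x \<xi> i\<bar>) powr (s - 2))"
      using c[of "{1..n}" "wscale s a x \<eta>" "wscale s a x \<xi>"] less by (simp add: eqs)
  qed
qed

end
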